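(* Let $\psi_1,\psi_2:\mathcal{H}\to\mathbb{R}$ be functions of class $C^2$, both bounded below, satisfying $\|\nabla\psi_1(x)\|=\|\nabla\psi_2(x)\|$ for all $x\in\mathcal{H}$. If $V(x)=\frac12\|\nabla\psi_1(x)\|^2\ \left(=\frac12\|\nabla\psi_2(x)\|^2\right)$ is convex on $\mathcal{H}$, then both $\psi_1$ and $\psi_2$ are convex and they are equal up to an additive constant.
   Context: $\mathcal{H}$ is a real Hilbert space with norm $\|\cdot\|$; $\nabla$ denotes the gradient. *)

theory Defs
  imports "HOL-Analysis.Analysis"
begin

text \<open>
  Class \<open>C\<^sup>2\<close> on the whole space: \<open>f\<close> is twice Frechet differentiable, and the second
  derivative is continuous for the operator norm. The derivatives are valued in spaces of
  bounded linear maps.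
\<close>

definition class_C2 :: "('a::real_normed_vector \<Rightarrow> 'b::real_normed_vector) \<Rightarrow> bool" where
  "class_C2 f \<longleftrightarrow>
     (\<exists>(f' :: 'a \<Rightarrow> ('a \<Rightarrow>\<^sub>L 'b)) (f'' :: 'a \<Rightarrow> ('a \<Rightarrow>\<^sub>L ('a \<Rightarrow>\<^sub>L 'b))).
        (\<forall>x. (f has_derivative blinfun_apply (f' x)) (at x)) \<and>
        (\<forall>x. (f' has_derivative blinfun_apply (f'' x)) (at x)) \<and>
        continuous_on UNIV f'')"

text \<open>
  Only meaningful where a gradient exists; on a Hilbert space this is every point of Frechet
  differentiability, by the Riesz representation theorem.
\<close>

definition gradient :: "('a::real_inner \<Rightarrow> real) \<Rightarrow> 'a \<Rightarrow> 'a" where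
  "gradient f x = (THE D. GDERIV f x :> D)"

lemma gradient_eq:
  assumes "GDERIV f x :> D"
  shows "gradient f x = D"
  unfolding gradient_def
proof (rule the_equality)
  show "GDERIV f x :> D" by (rule assms)
next
  fix E assume "GDERIV f x :> E"
  with assms have "(\<lambda>h. inner h E) = (\<lambda>h. inner h D)"
    unfolding gderiv_def by (rule has_derivative_unique[rotated])
  then have "inner (E - D) (E - D) = 0"
    by (metis inner_diff_right right_minus_eq)
  then show "E = D" by simp
qed

end

theory Submission
  imports Defs
begin

text \<open>
  Along a steepest descent curve \<open>x' = -\<nabla>\<psi>(x)\<close> one has
  \<open>x'' = D\<^sup>2\<psi>(x) \<nabla>\<psi>(x) = \<nabla>V(x)\<close>, because \<open>D\<^sup>2\<psi>(x)\<close> is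
  self-adjoint. So the descent curves of \<open>\<psi>\<^sub>1\<close> and of \<open>\<psi>\<^sub>2\<close> solve the
  same second order equation, whose right-hand side is monotone since \<open>V\<close> is convex. If \<open>x\<close>
  is a descent curve of \<open>\<psi>\<^sub>i\<close> and \<open>y\<close> one of \<open>\<psi>\<^sub>j\<close>, where \<open>i\<close> and \<open>j\<close> may be equal,
  then the second derivative of \<open>\<parallel>x - y\<parallel>\<^sup>2\<close>, namely
  \<open>2\<parallel>x' - y'\<parallel>\<^sup>2 + 2\<langle>x - y, \<nabla>V(x) - \<nabla>V(y)\<rangle>\<close>, is nonnegative.
  A convex function that increases somewhere grows at least linearly from then on. But the speeds
  are square integrable because \<open>\<psi>\<^sub>i\<close> and \<open>\<psi>\<^sub>j\<close> are bounded below, so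
  \<open>\<parallel>x - y\<parallel>\<^sup>2\<close> is sublinear. Hence it never increases, and at time zero this says
  \<open>\<langle>x - y, \<nabla>\<psi>\<^sub>i(x) - \<nabla>\<psi>\<^sub>j(y)\<rangle> \<ge> 0\<close> for all points \<open>x\<close> and \<open>y\<close>
  (\<open>gradients_cross_monotone\<close>).

  With \<open>i = j\<close>, the gradient of \<open>\<psi>\<^sub>i\<close> is monotone and \<open>\<psi>\<^sub>i\<close> is convex. With
  \<open>i = 1\<close>, \<open>j = 2\<close>, letting \<open>x\<close> tend to \<open>y\<close> along a ray in any direction gives
  \<open>\<nabla>\<psi>\<^sub>1(y) = \<nabla>\<psi>\<^sub>2(y)\<close>, and the functions differ by a constant.

  The proof of the cross inequality below avoids solving differential equations. Ekeland's
  variational principle (\<open>ekeland_variational_principle\<close>) replaces the limit of the curves: on a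
  suitable closed set of pairs \<open>(x, y)\<close> it yields a point from which no move inside the set
  decreases \<open>\<psi>\<^sub>i(x) + \<psi>\<^sub>j(y)\<close> proportionally to its length, whereas a short step along the
  negative gradient is exactly such a move.
\<close>

section \<open>Gradients in a Hilbert space\<close>

text \<open>
  The representing vector is the minimiser of \<open>\<parallel>x\<parallel>\<^sup>2 / 2 - f x\<close>. Minimising
  sequences converge by the parallelogram identity, and the vanishing of the derivative at the
  minimiser is the representation formula.
\<close>

lemma riesz_representation:
  fixes f :: "'a::{real_inner, complete_space} \<Rightarrow> real"
  assumes "bounded_linear f"
  shows "\<exists>y. \<forall>x. f x = inner x y"
proof -
  interpret f: bounded_linear f by fact
  define J where "J x = inner x x / 2 - f x" for x
  obtain K where K: "\<And>x. norm (f x) \<le> norm x * K"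
    using f.bounded by blast
  have "- (K\<^sup>2) / 2 \<le> J x" for x
  proof -
    have "f x \<le> norm x * K" using K[of x] by simp
    moreover have "0 \<le> (norm x - K)\<^sup>2" by simp
    ultimately show ?thesis
      by (simp add: J_def power2_norm_eq_inner[symmetric] power2_eq_square algebra_simps)
  qed
  then have bdd: "bdd_below (range J)" by (intro bdd_belowI2)
  define m where "m = Inf (range J)"
  have m: "m \<le> J x" for x unfolding m_def by (intro cInf_lower bdd) simp
  have "\<exists>x. J x < m + inverse (real (Suc n))" for n
    using cInf_lessD[of "range J" "m + inverse (real (Suc n))"] by (auto simp: m_def)
  then obtain X where X: "\<And>n. J (X n) < m + inverse (real (Suc n))" by metis
  have parallelogram: "(norm (a - b))\<^sup>2 = 4 * (J a + J b - 2 * J ((1/2) *\<^sub>R (a + b)))" for a b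
    by (simp add: J_def power2_norm_eq_inner f.add f.scaleR inner_add inner_diff inner_commute
        field_simps)
  have close: "(norm (X i - X j))\<^sup>2 < 8 * inverse (real (Suc n))" if "n \<le> i" "n \<le> j" for i j n
  proof -
    define r where "r = inverse (real (Suc n))"
    have "inverse (real (Suc i)) \<le> r" "inverse (real (Suc j)) \<le> r"
      using that by (auto simp: r_def intro!: le_imp_inverse_le)
    then have "J (X i) < m + r" "J (X j) < m + r"
      using X[of i] X[of j] by linarith+
    moreover define c where "c = J ((1/2) *\<^sub>R (X i + X j))"
    have "m \<le> c" unfolding c_def by (rule m)
    ultimately have "J (X i) + J (X j) - 2 * c < 2 * r" by (smt (verit))
    then have "4 * (J (X i) + J (X j) - 2 * c) < 8 * r" by simp
    then show ?thesis unfolding parallelogram r_def c_def .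
  qed
  have "Cauchy X"
  proof (rule metric_CauchyI)
    fix e :: real assume "0 < e"
    then obtain n where n: "inverse (real (Suc n)) < e\<^sup>2 / 8"
      using reals_Archimedean[of "e\<^sup>2 / 8"] by auto
    have "dist (X i) (X j) < e" if "n \<le> i" "n \<le> j" for i j
    proof -
      have "(norm (X i - X j))\<^sup>2 < e\<^sup>2" using close[OF that] n by simp
      then show ?thesis using \<open>0 < e\<close> by (simp add: dist_norm power_less_imp_less_base)
    qed
    then show "\<exists>M. \<forall>i\<ge>M. \<forall>j\<ge>M. dist (X i) (X j) < e" by blast
  qed
  then obtain y where y: "X \<longlonglongrightarrow> y" using Cauchy_convergent convergent_def by blast
  have "(\<lambda>n. J (X n)) \<longlonglongrightarrow> J y"
    unfolding J_def by (intro tendsto_intros f.tendsto y) auto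
  moreover have "(\<lambda>n. m + inverse (real (Suc n))) \<longlonglongrightarrow> m + 0"
    by (intro tendsto_intros LIMSEQ_inverse_real_of_nat)
  ultimately have "J y \<le> m + 0"
    by (rule LIMSEQ_le) (use X in \<open>auto intro: less_imp_le\<close>)
  then have min: "J y \<le> J x" for x using m[of x] by simp
  have "f x = inner x y" for x
  proof -
    have "((\<lambda>t. J (y + t *\<^sub>R x)) has_real_derivative (inner x y - f x)) (at 0)"
      unfolding J_def
      by (auto simp: inner_add f.add f.scaleR inner_commute intro!: derivative_eq_intros)
    then have "inner x y - f x = 0"
      by (rule DERIV_local_min[of _ _ _ 1]) (auto simp: min)
    then show ?thesis by simp
  qed
  then show ?thesis by blast
qed

text \<open>
  The Riesz isomorphism is bounded and linear, so it carries differentiability of the dual-valued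
  derivative over to the gradient.
\<close>

lemma class_C2_gradient:
  fixes f :: "'a::{real_inner, complete_space} \<Rightarrow> real"
  assumes "class_C2 f"
  obtains A where "\<And>x. GDERIV f x :> gradient f x"
    and "\<And>x. (gradient f has_derivative A x) (at x)"
proof -
  from assms obtain f' :: "'a \<Rightarrow> 'a \<Rightarrow>\<^sub>L real" and f'' :: "'a \<Rightarrow> 'a \<Rightarrow>\<^sub>L 'a \<Rightarrow>\<^sub>L real"
    where f': "\<And>x. (f has_derivative blinfun_apply (f' x)) (at x)"
      and f'': "\<And>x. (f' has_derivative blinfun_apply (f'' x)) (at x)"
    unfolding class_C2_def by blast
  have "\<exists>y. \<forall>x. blinfun_apply \<phi> x = inner x y" for \<phi> :: "'a \<Rightarrow>\<^sub>L real"
    by (rule riesz_representation) (rule blinfun.bounded_linear_right)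
  then obtain R where R: "\<And>(\<phi> :: 'a \<Rightarrow>\<^sub>L real) x. blinfun_apply \<phi> x = inner x (R \<phi>)"
    by metis
  have "bounded_linear R"
  proof (rule bounded_linear_intro[where K = 1])
    fix \<phi> \<theta> :: "'a \<Rightarrow>\<^sub>L real" and r :: real
    show "R (\<phi> + \<theta>) = R \<phi> + R \<theta>"
      by (rule vector_eq_rdot[THEN iffD1])
        (metis R blinfun.add_left inner_add_right inner_commute)
    show "R (r *\<^sub>R \<phi>) = r *\<^sub>R R \<phi>"
      by (rule vector_eq_rdot[THEN iffD1])
        (metis R blinfun.scaleR_left inner_scaleR_right inner_commute real_scaleR_def)
    have "norm (R \<phi>) * norm (R \<phi>) \<le> norm \<phi> * norm (R \<phi>)"
      using R[of \<phi> "R \<phi>"] norm_blinfun[of \<phi> "R \<phi>"]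
      by (simp add: power2_norm_eq_inner[symmetric] power2_eq_square)
    then show "norm (R \<phi>) \<le> norm \<phi> * 1"
      by (cases "R \<phi> = 0") auto
  qed
  then have "((\<lambda>x. R (f' x)) has_derivative (\<lambda>h. R (f'' x h))) (at x)" for x
    by (rule bounded_linear.has_derivative) (rule f'')
  moreover have G: "GDERIV f x :> R (f' x)" for x
    unfolding gderiv_def R[symmetric] by (rule f')
  moreover have "gradient f = (\<lambda>x. R (f' x))"
    using gradient_eq[OF G] by blast
  ultimately show ?thesis using that[of "\<lambda>x h. R (f'' x h)"] by simp
qed

lemma GDERIV_along_line:
  assumes "GDERIV f (x + t *\<^sub>R v) :> D"
  shows "((\<lambda>s. f (x + s *\<^sub>R v)) has_real_derivative inner v D) (at t)"
proof -
  have "((\<lambda>s. x + s *\<^sub>R v) has_derivative (\<lambda>s. s *\<^sub>R v)) (at t)"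
    by (auto intro!: derivative_eq_intros)
  from has_derivative_compose[OF this assms[unfolded gderiv_def]]
  show ?thesis by (simp add: has_field_derivative_def mult_commute_abs)
qed

text \<open>
  The second difference of \<open>f\<close> over a parallelogram is symmetric in its two sides, while its
  leading term is the second derivative at \<open>(h, k)\<close>. This yields the symmetry of the second
  derivative from differentiability of the gradient at the single point \<open>x\<close>.
\<close>

lemma second_difference_bound:
  fixes f :: "'a::real_inner \<Rightarrow> real"
  assumes f: "\<And>x. GDERIV f x :> g x"
    and g: "(g has_derivative A) (at x)"
    and "0 < e"
  shows "\<exists>d>0. \<forall>t. 0 < t \<and> t < d \<longrightarrow>
    \<bar>f (x + t *\<^sub>R h + t *\<^sub>R k) - f (x + t *\<^sub>R h) - f (x + t *\<^sub>R k) + f x - t\<^sup>2 * inner (A h) k\<bar>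
      \<le> e * t\<^sup>2"
proof -
  interpret A: bounded_linear A using g by (rule has_derivative_bounded_linear)
  define r where "r = norm h + norm k + 1"
  have r: "1 \<le> r" by (simp add: r_def)
  define e' where "e' = e / (2 * r\<^sup>2)"
  have e': "0 < e'" using \<open>0 < e\<close> r by (simp add: e'_def)
  obtain d where d: "0 < d"
    "\<And>y. norm (y - x) < d \<Longrightarrow> norm (g y - g x - A (y - x)) \<le> e' * norm (y - x)"
    using g e' unfolding has_derivative_at_alt by blast
  have rem: "norm (g (x + w) - g x - A w) \<le> e' * (t * r)" if "norm w \<le> t * r" "t * r < d" for w t
  proof -
    have "norm (g (x + w) - g x - A w) \<le> e' * norm w" using d(2)[of "x + w"] that by simp
    also have "\<dots> \<le> e' * (t * r)" using that e' by simp
    finally show ?thesis .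
  qed
  have "\<bar>f (x + t *\<^sub>R h + t *\<^sub>R k) - f (x + t *\<^sub>R h) - f (x + t *\<^sub>R k) + f x - t\<^sup>2 * inner (A h) k\<bar>
      \<le> e * t\<^sup>2" (is "\<bar>?S - _\<bar> \<le> _") if t: "0 < t" "t < d / r" for t
  proof -
    have tr: "t * r < d" using t r by (simp add: field_simps)
    \<comment> \<open>The second difference is the increment over \<open>[0, t]\<close> of a first difference in direction
      \<open>h\<close>; the mean value theorem turns it into a difference of gradients near \<open>x\<close>.\<close>
    have "((\<lambda>s. f (x + t *\<^sub>R h + s *\<^sub>R k) - f (x + s *\<^sub>R k)) has_real_derivative
        (inner k (g (x + t *\<^sub>R h + s *\<^sub>R k)) - inner k (g (x + s *\<^sub>R k)))) (at s)" for s
      by (intro DERIV_diff GDERIV_along_line f)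
    from MVT2[OF \<open>0 < t\<close> this] obtain s where s: "0 < s" "s < t"
      and S: "?S = t * inner k (g (x + t *\<^sub>R h + s *\<^sub>R k) - g (x + s *\<^sub>R k))"
      by (auto simp: inner_diff_right)
    define w where "w = s *\<^sub>R k"
    have nw: "norm w \<le> t * norm k" using s by (simp add: w_def mult_right_mono)
    have "t * norm k \<le> t * r" using t by (intro mult_left_mono) (auto simp: r_def)
    then have "norm w \<le> t * r" using nw by linarith
    then have 1: "norm (g (x + w) - g x - A w) \<le> e' * (t * r)" using tr by (rule rem)
    have "norm (t *\<^sub>R h + w) \<le> t * r"
      using norm_triangle_ineq[of "t *\<^sub>R h" w] nw t by (simp add: r_def distrib_left)
    then have 2: "norm (g (x + (t *\<^sub>R h + w)) - g x - A (t *\<^sub>R h + w)) \<le> e' * (t * r)"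
      using tr by (rule rem)
    let ?R = "g (x + t *\<^sub>R h + w) - g (x + w) - t *\<^sub>R A h"
    have "?R = (g (x + (t *\<^sub>R h + w)) - g x - A (t *\<^sub>R h + w)) - (g (x + w) - g x - A w)"
      by (simp add: A.add A.scaleR algebra_simps)
    also have "norm \<dots> \<le> e' * (t * r) + e' * (t * r)"
      by (rule order_trans[OF norm_triangle_ineq4 add_mono[OF 2 1]])
    finally have R: "norm ?R \<le> 2 * e' * (t * r)" by linarith
    have "?S - t\<^sup>2 * inner (A h) k = t * inner k ?R"
      unfolding S w_def[symmetric] by (simp add: inner_diff inner_commute power2_eq_square algebra_simps)
    then have "\<bar>?S - t\<^sup>2 * inner (A h) k\<bar> = t * \<bar>inner k ?R\<bar>" using t by (simp add: abs_mult)
    also have "\<dots> \<le> t * (norm k * norm ?R)"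
      using t Cauchy_Schwarz_ineq2[of k ?R] by (intro mult_left_mono) auto
    also have "\<dots> \<le> t * (r * (2 * e' * (t * r)))"
      using t R r by (intro mult_left_mono mult_mono) (auto simp: r_def)
    also have "\<dots> = e * t\<^sup>2" using r by (simp add: e'_def power2_eq_square field_simps)
    finally show ?thesis .
  qed
  moreover have "0 < d / r" using d r by simp
  ultimately show ?thesis by blast
qed

lemma derivative_of_gradient_selfadjoint:
  fixes f :: "'a::real_inner \<Rightarrow> real"
  assumes f: "\<And>x. GDERIV f x :> g x"
    and g: "(g has_derivative A) (at x)"
  shows "inner (A h) k = inner (A k) h"
proof (rule ccontr)
  assume ne: "inner (A h) k \<noteq> inner (A k) h"
  define e where "e = \<bar>inner (A h) k - inner (A k) h\<bar> / 3"
  have e: "0 < e" using ne by (simp add: e_def)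
  obtain d1 d2 where d1: "0 < d1" "\<forall>t. 0 < t \<and> t < d1 \<longrightarrow>
    \<bar>f (x + t *\<^sub>R h + t *\<^sub>R k) - f (x + t *\<^sub>R h) - f (x + t *\<^sub>R k) + f x - t\<^sup>2 * inner (A h) k\<bar>
      \<le> e * t\<^sup>2"
   and d2: "0 < d2" "\<forall>t. 0 < t \<and> t < d2 \<longrightarrow>
    \<bar>f (x + t *\<^sub>R k + t *\<^sub>R h) - f (x + t *\<^sub>R k) - f (x + t *\<^sub>R h) + f x - t\<^sup>2 * inner (A k) h\<bar>
      \<le> e * t\<^sup>2"
    using second_difference_bound[OF f g e] by metis
  define t where "t = min d1 d2 / 2"
  have t: "0 < t" "t < d1" "t < d2" using d1 d2 by (auto simp: t_def)
  have "x + t *\<^sub>R k + t *\<^sub>R h = x + t *\<^sub>R h + t *\<^sub>R k" by simp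
  then have "\<bar>t\<^sup>2 * inner (A h) k - t\<^sup>2 * inner (A k) h\<bar> \<le> 2 * (e * t\<^sup>2)"
    using d1(2)[rule_format, of t] d2(2)[rule_format, of t] t by (smt (verit))
  then have "t\<^sup>2 * \<bar>inner (A h) k - inner (A k) h\<bar> \<le> t\<^sup>2 * (2 * e)"
    unfolding right_diff_distrib[symmetric] abs_mult abs_power2 by (simp add: mult_ac)
  then have "\<bar>inner (A h) k - inner (A k) h\<bar> \<le> 2 * e"
    using t by simp
  then show False using ne by (simp add: e_def)
qed

text \<open>
  The derivative in direction \<open>h\<close> is \<open>\<langle>g x, A h\<rangle>\<close>; self-adjointness of \<open>A\<close> moves it onto
  \<open>g x\<close>. So the acceleration of a steepest descent curve depends on the norm of the gradient
  only.
\<close>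

lemma GDERIV_half_norm_gradient_squared:
  fixes f :: "'a::real_inner \<Rightarrow> real"
  assumes f: "\<And>x. GDERIV f x :> g x" and g: "(g has_derivative A) (at x)"
  shows "GDERIV (\<lambda>x. 1/2 * (norm (g x))\<^sup>2) x :> A (g x)"
proof -
  have "((\<lambda>x. 1/2 * inner (g x) (g x)) has_derivative
      (\<lambda>h. 1/2 * (inner (g x) (A h) + inner (A h) (g x)))) (at x)"
    by (intro has_derivative_mult_right has_derivative_inner g)
  then show ?thesis
    by (simp add: gderiv_def power2_norm_eq_inner inner_commute
        derivative_of_gradient_selfadjoint[OF f g, of _ "g x"])
qed

section \<open>Convexity and monotone gradients\<close>

lemma convex_on_imp_above_gradient_tangent:
  fixes V :: "'a::real_inner \<Rightarrow> real"
  assumes "convex_on UNIV V" and "GDERIV V x :> D"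
  shows "V x + inner (y - x) D \<le> V y"
proof -
  let ?\<phi> = "\<lambda>t. V (x + t *\<^sub>R (y - x))"
  have "convex_on UNIV ?\<phi>"
  proof (rule convex_onI)
    fix t a b :: real assume t: "0 < t" "t < 1"
    have "x + ((1 - t) *\<^sub>R a + t *\<^sub>R b) *\<^sub>R (y - x)
        = (1 - t) *\<^sub>R (x + a *\<^sub>R (y - x)) + t *\<^sub>R (x + b *\<^sub>R (y - x))"
      by (simp add: algebra_simps)
    then show "?\<phi> ((1 - t) *\<^sub>R a + t *\<^sub>R b) \<le> (1 - t) * ?\<phi> a + t * ?\<phi> b"
      using convex_onD[OF assms(1), of t] t by simp
  qed simp
  moreover have "(?\<phi> has_real_derivative inner (y - x) D) (at 0 within UNIV)"
    by (rule GDERIV_along_line) (use assms(2) in simp)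
  ultimately have "inner (y - x) D * (1 - 0) \<le> ?\<phi> 1 - ?\<phi> 0"
    by (intro convex_on_imp_above_tangent[of UNIV ?\<phi> 0 1]) auto
  then show ?thesis by simp
qed

lemma convex_on_gradient_monotone:
  fixes V :: "'a::real_inner \<Rightarrow> real"
  assumes "convex_on UNIV V" and "\<And>x. GDERIV V x :> G x"
  shows "0 \<le> inner (x - y) (G x - G y)"
  using convex_on_imp_above_gradient_tangent[OF assms, of x y]
    convex_on_imp_above_gradient_tangent[OF assms, of y x]
  by (simp add: inner_diff)

lemma convex_on_if_gradient_monotone:
  fixes f :: "'a::real_inner \<Rightarrow> real"
  assumes f: "\<And>x. GDERIV f x :> g x"
    and mono: "\<And>x y. 0 \<le> inner (x - y) (g x - g y)"
  shows "convex_on UNIV f"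
proof (rule convex_onI)
  fix t :: real and x y :: 'a assume t: "0 < t" "t < 1"
  let ?\<phi> = "\<lambda>s. f (x + s *\<^sub>R (y - x))"
  have "convex_on UNIV ?\<phi>"
  proof (rule convex_on_realI[OF connected_UNIV])
    show "(?\<phi> has_real_derivative inner (y - x) (g (x + s *\<^sub>R (y - x)))) (at s)" for s
      by (rule GDERIV_along_line) (rule f)
    fix a b :: real assume "a \<le> b"
    show "inner (y - x) (g (x + a *\<^sub>R (y - x))) \<le> inner (y - x) (g (x + b *\<^sub>R (y - x)))"
    proof (cases "a = b")
      case False
      then have "0 < b - a" using \<open>a \<le> b\<close> by simp
      have "(x + b *\<^sub>R (y - x)) - (x + a *\<^sub>R (y - x)) = (b - a) *\<^sub>R (y - x)"
        by (simp add: algebra_simps)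
      then have "0 \<le> (b - a) * inner (y - x) (g (x + b *\<^sub>R (y - x)) - g (x + a *\<^sub>R (y - x)))"
        using mono[of "x + b *\<^sub>R (y - x)" "x + a *\<^sub>R (y - x)"] by simp
      then show ?thesis using \<open>0 < b - a\<close> by (simp add: zero_le_mult_iff inner_diff_right)
    qed simp
  qed
  from convex_onD[OF this, of t 0 1] t
  have "?\<phi> t \<le> (1 - t) * f x + t * f y" by simp
  moreover have "x + t *\<^sub>R (y - x) = (1 - t) *\<^sub>R x + t *\<^sub>R y" by (simp add: algebra_simps)
  ultimately show "f ((1 - t) *\<^sub>R x + t *\<^sub>R y) \<le> (1 - t) * f x + t * f y" by simp
qed simp

section \<open>Ekeland's variational principle\<close>

text \<open>
  Write \<open>w \<in> T z\<close> if moving from \<open>z\<close> to \<open>w\<close> pays for its length by a decrease of \<open>F\<close>; this is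
  a transitive relation. Choosing greedily, each time realising at least half of the decrease that
  is still possible, gives a Cauchy sequence: its length is bounded by the total decrease of
  \<open>F\<close>. At its limit no further decrease is possible.
\<close>

lemma ekeland_variational_principle:
  fixes F :: "'a::complete_space \<Rightarrow> real"
  assumes S: "closed S" "S \<noteq> {}" and F: "continuous_on S F" "bdd_below (F ` S)" and "0 < c"
  obtains z where "z \<in> S" and "\<And>w. w \<in> S \<Longrightarrow> F w + c * dist z w \<le> F z \<Longrightarrow> w = z"
proof -
  define T where "T z = {w \<in> S. F w + c * dist z w \<le> F z}" for z
  have T_trans: "w \<in> T z" if "v \<in> T z" "w \<in> T v" for z v w
  proof -
    have "c * dist z w \<le> c * dist z v + c * dist v w"
      using mult_left_mono[OF dist_triangle[of z w v], of c] \<open>0 < c\<close> by (simp add: distrib_left)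
    then show ?thesis using that by (auto simp: T_def)
  qed
  have bdd: "bdd_below (F ` T z)" for z
    by (rule bdd_below_mono[OF F(2)]) (auto simp: T_def)
  have step: "\<exists>w. w \<in> S \<and> w \<in> T z \<and> 2 * F w \<le> F z + Inf (F ` T z)" if "z \<in> S" for z
  proof -
    have z: "z \<in> T z" using that by (simp add: T_def)
    then have le: "Inf (F ` T z) \<le> F z" by (intro cInf_lower bdd) auto
    show ?thesis
    proof (cases "Inf (F ` T z) = F z")
      case True
      then show ?thesis using z that by (intro exI[of _ z]) simp
    next
      case False
      then have "Inf (F ` T z) < (F z + Inf (F ` T z)) / 2" using le by simp
      then obtain w where "w \<in> T z" "F w < (F z + Inf (F ` T z)) / 2"
        using cInf_lessD[of "F ` T z"] z by blast
      then show ?thesis by (intro exI[of _ w]) (auto simp: T_def)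
    qed
  qed
  obtain z0 where "z0 \<in> S" using S by blast
  then obtain Z where Z: "\<And>n. Z n \<in> S"
      and Z_step: "\<And>n. Z (Suc n) \<in> T (Z n) \<and> 2 * F (Z (Suc n)) \<le> F (Z n) + Inf (F ` T (Z n))"
    using dependent_nat_choice[of "\<lambda>n z. z \<in> S"
        "\<lambda>n z w. w \<in> T z \<and> 2 * F w \<le> F z + Inf (F ` T z)"] step
    by metis
  have Z_T: "Z m \<in> T (Z n)" if "n \<le> m" for n m
    using that
  proof (induction m rule: dec_induct)
    case base
    then show ?case using Z by (simp add: T_def)
  next
    case (step k)
    then show ?case using T_trans Z_step by blast
  qed
  have dist_le: "c * dist (Z n) (Z m) \<le> F (Z n) - F (Z m)" if "n \<le> m" for n m
    using Z_T[OF that] by (simp add: T_def)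
  have "decseq (\<lambda>n. F (Z n))"
  proof (rule decseq_SucI)
    fix n
    have "0 \<le> c * dist (Z n) (Z (Suc n))" using \<open>0 < c\<close> by simp
    then show "F (Z (Suc n)) \<le> F (Z n)" using dist_le[of n "Suc n"] by simp
  qed
  moreover obtain b where b: "\<And>n. b \<le> F (Z n)"
    using F(2) Z unfolding bdd_below_def by blast
  ultimately obtain L where L: "(\<lambda>n. F (Z n)) \<longlonglongrightarrow> L" "\<And>n. L \<le> F (Z n)"
    using decseq_convergent[of "\<lambda>n. F (Z n)" b] by metis
  have "Cauchy Z"
  proof (rule CauchyI')
    fix e :: real assume "0 < e"
    then have "L < L + c * e" using \<open>0 < c\<close> by simp
    then obtain M where M: "\<And>n. n \<ge> M \<Longrightarrow> F (Z n) < L + c * e"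
      using order_tendstoD(2)[OF L(1)] unfolding eventually_sequentially by blast
    have "dist (Z m) (Z n) < e" if "m \<ge> M" "m < n" for m n
    proof -
      have "c * dist (Z m) (Z n) < c * e"
        using dist_le[of m n] M[of m] L(2)[of n] that by simp
      then show ?thesis using \<open>0 < c\<close> by simp
    qed
    then show "\<exists>M. \<forall>m\<ge>M. \<forall>n>m. dist (Z m) (Z n) < e" by blast
  qed
  then obtain z where z: "Z \<longlonglongrightarrow> z" using Cauchy_convergent convergent_def by blast
  have zS: "z \<in> S" using closed_sequentially[OF S(1)] Z z by blast
  have Fz: "(\<lambda>n. F (Z n)) \<longlonglongrightarrow> F z"
    using continuous_on_tendsto_compose[OF F(1) z zS] Z by simp
  have z_T: "z \<in> T (Z n)" for n
  proof -
    have "(\<lambda>m. F (Z m) + c * dist (Z n) (Z m)) \<longlonglongrightarrow> F z + c * dist (Z n) z"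
      by (intro tendsto_intros Fz z)
    then have "F z + c * dist (Z n) z \<le> F (Z n)"
    proof (rule LIMSEQ_le_const2)
      show "\<exists>N. \<forall>m\<ge>N. F (Z m) + c * dist (Z n) (Z m) \<le> F (Z n)"
        using dist_le by (intro exI[of _ n]) (auto simp: algebra_simps)
    qed
    then show ?thesis using zS by (simp add: T_def)
  qed
  have "w = z" if w: "w \<in> S" "F w + c * dist z w \<le> F z" for w
  proof -
    have "2 * F (Z (Suc n)) - F (Z n) \<le> F w" for n
    proof -
      have "w \<in> T (Z n)" using T_trans[OF z_T] w by (simp add: T_def)
      then have "Inf (F ` T (Z n)) \<le> F w" by (intro cInf_lower bdd) auto
      then show ?thesis using Z_step[of n] by linarith
    qed
    moreover have "(\<lambda>n. 2 * F (Z (Suc n)) - F (Z n)) \<longlonglongrightarrow> 2 * F z - F z"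
      using LIMSEQ_Suc[OF Fz] by (intro tendsto_intros Fz)
    ultimately have "2 * F z - F z \<le> F w" by (intro LIMSEQ_le_const2) auto
    then have "c * dist z w \<le> 0" using w by simp
    then show ?thesis using \<open>0 < c\<close> by (simp add: mult_le_0_iff)
  qed
  then show ?thesis using that zS by blast
qed

section \<open>Monotonicity across two potentials\<close>

text \<open>
  The assumption on \<open>A1\<close> and \<open>A2\<close> says that the accelerations of two steepest descent curves
  are monotone. Suppose \<open>q z = - \<langle>u, e\<rangle>\<close> equals \<open>q0 > 0\<close> at the start, where \<open>z = (x, y)\<close>,
  \<open>u = x - y\<close> and \<open>e = g1 x - g2 y\<close>. Along the descent flow of \<open>F z = f1 x + f2 y\<close>,
  \<^item> \<open>q' \<ge> \<parallel>e\<parallel>\<^sup>2 > 0\<close>, so \<open>q \<ge> q0\<close> persists;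
  \<^item> \<open>q0 \<le> q \<le> \<parallel>u\<parallel> \<parallel>e\<parallel>\<close>, and \<open>\<parallel>e\<parallel>\<^sup>2 \<le> 2 \<parallel>\<nabla>F\<parallel>\<^sup>2\<close>;
  \<^item> \<open>(\<parallel>u\<parallel>\<^sup>2)' = 2 q\<close> and \<open>F' = - \<parallel>\<nabla>F\<parallel>\<^sup>2\<close>. Hence
    \<open>W = \<parallel>u\<parallel>\<^sup>2 exp (F / \<kappa>)\<close> decreases as soon as \<open>2 q < \<parallel>u\<parallel>\<^sup>2 \<parallel>\<nabla>F\<parallel>\<^sup>2 / \<kappa>\<close>, whose right
    side is at least \<open>q0 q / (2 \<kappa>)\<close>; this dictates \<open>\<kappa> < q0 / 4\<close>.

  On the closed set \<open>S\<close> where \<open>q \<ge> q0\<close> and \<open>W\<close> is at most its initial value, the lower bound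
  on \<open>F\<close> bounds \<open>\<parallel>u\<parallel>\<close> by some \<open>M\<close>, and therefore \<open>\<parallel>\<nabla>F\<parallel>\<close> exceeds some \<open>c > 0\<close>. A short step
  along \<open>- \<nabla>F\<close> thus stays in \<open>S\<close> and decreases \<open>F\<close> by at least \<open>c\<close> times its length, which
  Ekeland's principle forbids at some point of \<open>S\<close>.
\<close>

lemma gradients_cross_monotone:
  fixes f1 f2 :: "'a::{real_inner, complete_space} \<Rightarrow> real"
  assumes f1: "\<And>x. GDERIV f1 x :> g1 x" and f2: "\<And>x. GDERIV f2 x :> g2 x"
    and g1: "\<And>x. (g1 has_derivative A1 x) (at x)" and g2: "\<And>x. (g2 has_derivative A2 x) (at x)"
    and "bdd_below (range f1)" and "bdd_below (range f2)"
    and mono: "\<And>x y. 0 \<le> inner (x - y) (A1 x (g1 x) - A2 y (g2 y))"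
  shows "0 \<le> inner (x - y) (g1 x - g2 y)"
proof (rule ccontr)
  define u where "u z = fst z - snd z" for z :: "'a \<times> 'a"
  define e where "e z = g1 (fst z) - g2 (snd z)" for z
  define q where "q z = - inner (u z) (e z)" for z
  define F where "F z = f1 (fst z) + f2 (snd z)" for z
  define q0 where "q0 = q (x, y)"
  assume "\<not> 0 \<le> inner (x - y) (g1 x - g2 y)"
  then have q0: "0 < q0" by (simp add: q0_def q_def u_def e_def)
  define \<kappa> where "\<kappa> = q0 / 8"
  have \<kappa>: "0 < \<kappa>" using q0 by (simp add: \<kappa>_def)
  define W where "W z = inner (u z) (u z) * exp (F z / \<kappa>)" for z
  define S where "S = {z. q0 \<le> q z} \<inter> {z. W z \<le> W (x, y)}"
  obtain b1 b2 where b: "\<And>x. b1 \<le> f1 x" "\<And>x. b2 \<le> f2 x"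
    using assms(5,6) unfolding bdd_below_def by blast
  have F_ge: "b1 + b2 \<le> F z" for z unfolding F_def using b by (intro add_mono)
  define M where "M = sqrt (W (x, y) * exp (- (b1 + b2) / \<kappa>)) + 1"
  have "0 \<le> W (x, y)" by (simp add: W_def)
  then have M: "0 < M" "W (x, y) * exp (- (b1 + b2) / \<kappa>) \<le> M\<^sup>2"
    by (auto simp: M_def power2_sum add_pos_nonneg add_nonneg_pos)
  have u_le: "norm (u z) \<le> M" if "z \<in> S" for z
  proof (rule power2_le_imp_le)
    have "inner (u z) (u z) * exp ((b1 + b2) / \<kappa>) \<le> W z"
      unfolding W_def using F_ge[of z] \<kappa> by (intro mult_left_mono) (auto simp: divide_right_mono)
    also have "\<dots> \<le> W (x, y)" using that by (simp add: S_def)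
    finally have "inner (u z) (u z) \<le> W (x, y) * exp (- (b1 + b2) / \<kappa>)"
      using exp_minus[of "(b1 + b2) / \<kappa>"] by (simp only: minus_divide_left) (simp add: field_simps)
    then show "(norm (u z))\<^sup>2 \<le> M\<^sup>2" using M by (simp add: power2_norm_eq_inner)
  qed (use M in simp)
  have cont1: "continuous_on UNIV g1" and cont2: "continuous_on UNIV g2"
    using g1 g2 by (auto intro!: continuous_at_imp_continuous_on has_derivative_continuous)
  have cont3: "continuous_on UNIV f1" and cont4: "continuous_on UNIV f2"
    using f1 f2 unfolding gderiv_def
    by (auto intro!: continuous_at_imp_continuous_on has_derivative_continuous)
  note cont = continuous_on_compose2[OF cont1] continuous_on_compose2[OF cont2]
    continuous_on_compose2[OF cont3] continuous_on_compose2[OF cont4]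
  have "continuous_on UNIV q" "continuous_on UNIV W" and contF: "continuous_on UNIV F"
    unfolding q_def W_def u_def e_def F_def using \<kappa> by (intro continuous_intros cont; simp)+
  then have "closed S" unfolding S_def by (intro closed_Int closed_Collect_le continuous_intros)
  moreover have "S \<noteq> {}" using q0 by (auto simp: S_def q0_def intro!: exI[of _ "(x, y)"])
  moreover have "continuous_on S F" using contF by (rule continuous_on_subset) simp
  moreover have "bdd_below (F ` S)" using F_ge by (intro bdd_belowI2)
  \<comment> \<open>On \<open>S\<close>, \<open>\<parallel>\<nabla>F\<parallel> \<ge> \<parallel>e\<parallel> / \<surd>2 \<ge> q0 / (\<surd>2 M) > c\<close>.\<close>
  moreover define c where "c = q0 / (2 * M)"
  have c: "0 < c" using q0 M by (simp add: c_def)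
  ultimately obtain z where z: "z \<in> S" and z_min: "\<And>w. w \<in> S \<Longrightarrow> F w + c * dist z w \<le> F z \<Longrightarrow> w = z"
    using ekeland_variational_principle[of S F c] by blast
  obtain a b where ab: "z = (a, b)" by (cases z)
  define v where "v = (- g1 a, - g2 b)"
  have v_sq: "(norm v)\<^sup>2 = inner (g1 a) (g1 a) + inner (g2 b) (g2 b)"
    by (simp add: v_def power2_norm_eq_inner)
  have e_sq: "(norm (e z))\<^sup>2 \<le> 2 * (norm v)\<^sup>2"
  proof -
    have "0 \<le> inner (g1 a + g2 b) (g1 a + g2 b)" by simp
    then show ?thesis unfolding v_sq
      by (simp add: ab e_def power2_norm_eq_inner inner_add inner_diff inner_commute)
  qed
  have q_z: "q0 \<le> q z" using z by (simp add: S_def)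
  have q_le: "q z \<le> norm (u z) * norm (e z)"
    using Cauchy_Schwarz_ineq2[of "u z" "e z"] by (simp add: q_def)
  have "q0 \<le> M * norm (e z)"
    using q_z q_le mult_right_mono[OF u_le[OF z], of "norm (e z)"] by simp
  then have e_ge: "2 * c \<le> norm (e z)" using M by (simp add: c_def field_simps)
  then have e_pos: "0 < norm (e z)" using c by linarith
  have "(2 * c)\<^sup>2 \<le> (norm (e z))\<^sup>2" using e_ge c by (intro power_mono) auto
  then have "2 * c\<^sup>2 \<le> (norm v)\<^sup>2" using e_sq by (simp add: power2_eq_square)
  moreover have "0 < c\<^sup>2" using c by simp
  ultimately have "c\<^sup>2 < (norm v)\<^sup>2" by linarith
  then have v_gt: "c < norm v" by (rule power_less_imp_less_base) simp
  \<comment> \<open>The steepest descent curve is replaced by its tangent line: only first derivatives at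
    \<open>z\<close> matter for a single step.\<close>
  define w where "w t = z + t *\<^sub>R v" for t
  have w_fst: "fst (w t) = a + t *\<^sub>R (- g1 a)" and w_snd: "snd (w t) = b + t *\<^sub>R (- g2 b)" for t
    by (simp_all add: w_def ab v_def)
  have w0: "w 0 = z" by (simp add: w_def)
  have dF: "((\<lambda>t. F (w t)) has_real_derivative - (norm v)\<^sup>2) (at 0)"
  proof -
    have "((\<lambda>t. F (w t)) has_real_derivative inner (- g1 a) (g1 a) + inner (- g2 b) (g2 b)) (at 0)"
      unfolding F_def w_fst w_snd by (intro DERIV_add GDERIV_along_line) (simp_all add: f1 f2)
    then show ?thesis unfolding v_sq by simp
  qed
  have du: "((\<lambda>t. u (w t)) has_derivative (\<lambda>t. t *\<^sub>R (- e z))) (at 0)"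
    unfolding u_def w_fst w_snd by (auto simp: e_def ab algebra_simps intro!: derivative_eq_intros)
  have de: "((\<lambda>t. e (w t)) has_derivative (\<lambda>t. t *\<^sub>R (- (A1 a (g1 a) - A2 b (g2 b))))) (at 0)"
  proof -
    interpret A1: bounded_linear "A1 a" using g1 by (rule has_derivative_bounded_linear)
    interpret A2: bounded_linear "A2 b" using g2 by (rule has_derivative_bounded_linear)
    have line: "((\<lambda>t. p + t *\<^sub>R d) has_derivative (\<lambda>t. t *\<^sub>R d)) (at 0)" for p d :: 'a
      by (auto intro!: derivative_eq_intros)
    have "((\<lambda>t. g1 (a + t *\<^sub>R (- g1 a))) has_derivative (\<lambda>t. A1 a (t *\<^sub>R (- g1 a)))) (at 0)"
      by (rule has_derivative_compose[OF line]) (simp add: g1)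
    moreover have "((\<lambda>t. g2 (b + t *\<^sub>R (- g2 b))) has_derivative (\<lambda>t. A2 b (t *\<^sub>R (- g2 b)))) (at 0)"
      by (rule has_derivative_compose[OF line]) (simp add: g2)
    ultimately have "((\<lambda>t. e (w t)) has_derivative
        (\<lambda>t. A1 a (t *\<^sub>R (- g1 a)) - A2 b (t *\<^sub>R (- g2 b)))) (at 0)"
      unfolding e_def w_fst w_snd by (rule has_derivative_diff)
    then show ?thesis by (simp add: A1.scaleR A2.scaleR A1.neg A2.neg algebra_simps)
  qed
  have dN: "((\<lambda>t. inner (u (w t)) (u (w t))) has_real_derivative 2 * q z) (at 0)"
    unfolding has_field_derivative_def
    by (rule has_derivative_eq_rhs[OF has_derivative_inner[OF du du]])
      (auto simp: w0 q_def inner_commute)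
  have dW: "((\<lambda>t. W (w t)) has_real_derivative
      (2 * q z - inner (u z) (u z) * (norm v)\<^sup>2 / \<kappa>) * exp (F z / \<kappa>)) (at 0)"
    unfolding W_def using \<kappa>
    by (auto simp: w0 algebra_simps intro!: derivative_eq_intros dN dF)
  have dq: "((\<lambda>t. q (w t)) has_real_derivative
      (norm (e z))\<^sup>2 + inner (a - b) (A1 a (g1 a) - A2 b (g2 b))) (at 0)"
    unfolding has_field_derivative_def q_def
    by (rule has_derivative_eq_rhs[OF has_derivative_minus[OF has_derivative_inner[OF du de]]])
      (simp add: w0 power2_norm_eq_inner u_def ab fun_eq_iff inner_diff_right algebra_simps)
  have "2 * q z - inner (u z) (u z) * (norm v)\<^sup>2 / \<kappa> < 0"
  proof -
    have "q0 * q z \<le> (q z)\<^sup>2" using q_z q0 by (simp add: power2_eq_square mult_right_mono)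
    also have "\<dots> \<le> (norm (u z) * norm (e z))\<^sup>2" using q_le q_z q0 by (intro power_mono) auto
    also have "\<dots> \<le> (norm (u z))\<^sup>2 * (2 * (norm v)\<^sup>2)"
      unfolding power_mult_distrib by (intro mult_left_mono e_sq) simp
    finally have "4 * \<kappa> * q z \<le> inner (u z) (u z) * (norm v)\<^sup>2"
      by (simp add: \<kappa>_def power2_norm_eq_inner)
    then have "4 * q z \<le> inner (u z) (u z) * (norm v)\<^sup>2 / \<kappa>" using \<kappa> by (simp add: field_simps)
    then show ?thesis using q_z q0 by linarith
  qed
  then have "(2 * q z - inner (u z) (u z) * (norm v)\<^sup>2 / \<kappa>) * exp (F z / \<kappa>) < 0"
    by (simp add: mult_neg_pos)
  from DERIV_neg_dec_right[OF dW this] obtain d1 where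
    d1: "0 < d1" "\<And>t. 0 < t \<Longrightarrow> t < d1 \<Longrightarrow> W (w t) < W z" by (auto simp: w0)
  have "0 < (norm (e z))\<^sup>2 + inner (a - b) (A1 a (g1 a) - A2 b (g2 b))"
    using e_pos by (intro add_pos_nonneg mono) simp
  from DERIV_pos_inc_right[OF dq this] obtain d2 where
    d2: "0 < d2" "\<And>t. 0 < t \<Longrightarrow> t < d2 \<Longrightarrow> q z < q (w t)" by (auto simp: w0)
  \<comment> \<open>The term \<open>t * (c * norm v)\<close> is \<open>c\<close> times the distance covered.\<close>
  have dE: "((\<lambda>t. F (w t) + t * (c * norm v)) has_real_derivative - (norm v)\<^sup>2 + c * norm v) (at 0)"
    by (auto intro!: derivative_eq_intros dF)
  have "- (norm v)\<^sup>2 + c * norm v < 0"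
  proof -
    have "0 < norm v" using v_gt c by linarith
    then have "c * norm v < norm v * norm v" by (rule mult_strict_right_mono[OF v_gt])
    then show ?thesis by (simp add: power2_eq_square)
  qed
  from DERIV_neg_dec_right[OF dE this] obtain d3 where
    d3: "0 < d3" "\<And>t. 0 < t \<Longrightarrow> t < d3 \<Longrightarrow> F (w t) + t * (c * norm v) < F z" by (auto simp: w0)
  define t where "t = min d1 (min d2 d3) / 2"
  have t: "0 < t" "t < d1" "t < d2" "t < d3" using d1 d2 d3 by (auto simp: t_def)
  have "w t \<in> S" using d1(2)[of t] d2(2)[of t] t z by (simp add: S_def)
  moreover have "dist z (w t) = t * norm v" using t by (simp add: w_def dist_norm)
  then have "F (w t) + c * dist z (w t) \<le> F z" using d3(2)[of t] t by (simp add: mult_ac)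
  ultimately have "w t = z" by (rule z_min)
  then show False using d2(2)[of t] t by simp
qed

section \<open>Potentials with equal slopes\<close>

theorem corollary3p20:
  fixes \<psi>\<^sub>1 \<psi>\<^sub>2 :: "'a::{real_inner, complete_space} \<Rightarrow> real"
  assumes "class_C2 \<psi>\<^sub>1" and "class_C2 \<psi>\<^sub>2"
    and "bdd_below (range \<psi>\<^sub>1)" and "bdd_below (range \<psi>\<^sub>2)"
    and "\<forall>x. norm (gradient \<psi>\<^sub>1 x) = norm (gradient \<psi>\<^sub>2 x)"
    and "convex_on UNIV (\<lambda>x. 1/2 * (norm (gradient \<psi>\<^sub>1 x))\<^sup>2)"
  shows "convex_on UNIV \<psi>\<^sub>1 \<and> convex_on UNIV \<psi>\<^sub>2 \<and> (\<exists>c. \<forall>x. \<psi>\<^sub>1 x = \<psi>\<^sub>2 x + c)"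
proof -
  let ?g1 = "gradient \<psi>\<^sub>1" and ?g2 = "gradient \<psi>\<^sub>2"
  let ?V = "\<lambda>x. 1/2 * (norm (?g1 x))\<^sup>2"
  obtain A1 where f1: "\<And>x. GDERIV \<psi>\<^sub>1 x :> ?g1 x" and g1: "\<And>x. (?g1 has_derivative A1 x) (at x)"
    by (rule class_C2_gradient[OF assms(1)]) (rule that)
  obtain A2 where f2: "\<And>x. GDERIV \<psi>\<^sub>2 x :> ?g2 x" and g2: "\<And>x. (?g2 has_derivative A2 x) (at x)"
    by (rule class_C2_gradient[OF assms(2)]) (rule that)
  have V1: "GDERIV ?V x :> A1 x (?g1 x)" for x
    by (rule GDERIV_half_norm_gradient_squared[OF f1 g1])
  have "GDERIV ?V x :> A2 x (?g2 x)" for x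
    using GDERIV_half_norm_gradient_squared[OF f2 g2] assms(5) by simp
  then have V2: "A2 x (?g2 x) = A1 x (?g1 x)" for x
    using V1 gradient_eq by metis
  have mono: "0 \<le> inner (x - y) (A1 x (?g1 x) - A1 y (?g1 y))" for x y
    by (rule convex_on_gradient_monotone[OF assms(6) V1])
  have "convex_on UNIV \<psi>\<^sub>1"
    by (rule convex_on_if_gradient_monotone[OF f1])
      (rule gradients_cross_monotone[OF f1 f1 g1 g1 assms(3,3) mono])
  moreover have "convex_on UNIV \<psi>\<^sub>2"
    by (rule convex_on_if_gradient_monotone[OF f2])
      (rule gradients_cross_monotone[OF f2 f2 g2 g2 assms(4,4)], simp add: V2 mono)
  moreover have eq: "?g1 y = ?g2 y" for y
  proof -
    \<comment> \<open>Taking \<open>x = y - t d\<close> in the cross inequality and letting \<open>t\<close> tend to zero from the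
      right gives \<open>\<parallel>d\<parallel>\<^sup>2 \<le> 0\<close>.\<close>
    define d where "d = ?g1 y - ?g2 y"
    have cross: "0 \<le> inner (x - y) (?g1 x - ?g2 y)" for x
      by (rule gradients_cross_monotone[OF f1 f2 g1 g2 assms(3,4)]) (simp add: V2 mono)
    have "((\<lambda>t. ?g1 (y - t *\<^sub>R d)) \<longlongrightarrow> ?g1 (y - 0 *\<^sub>R d)) (at_right 0)"
      using has_derivative_continuous[OF g1[of y]]
      by (intro isCont_tendsto_compose[of _ ?g1] tendsto_intros) auto
    then have "((\<lambda>t. inner d (?g1 (y - t *\<^sub>R d) - ?g2 y)) \<longlongrightarrow> inner d d) (at_right 0)"
      unfolding d_def by (auto intro!: tendsto_eq_intros)
    moreover have "\<forall>\<^sub>F t in at_right (0::real). inner d (?g1 (y - t *\<^sub>R d) - ?g2 y) \<le> 0"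
      using eventually_at_right_less[of "0::real"]
    proof eventually_elim
      case (elim t)
      then show ?case using cross[of "y - t *\<^sub>R d"] by (simp add: mult_le_0_iff zero_le_mult_iff)
    qed
    ultimately have "inner d d \<le> 0" by (intro tendsto_upperbound) auto
    then have "d = 0" by (metis inner_eq_zero_iff inner_ge_zero order_antisym)
    then show ?thesis by (simp add: d_def)
  qed
  have "((\<lambda>x. \<psi>\<^sub>1 x - \<psi>\<^sub>2 x) has_derivative (\<lambda>h. 0)) (at x)" for x
    using GDERIV_diff[OF f1 f2, of x] by (simp add: eq gderiv_def)
  then obtain c where "\<forall>x\<in>UNIV. \<psi>\<^sub>1 x - \<psi>\<^sub>2 x = c"
    using has_derivative_zero_constant[of UNIV "\<lambda>x. \<psi>\<^sub>1 x - \<psi>\<^sub>2 x"] by auto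
  then have "\<forall>x. \<psi>\<^sub>1 x = \<psi>\<^sub>2 x + c" by (simp add: algebra_simps)
  ultimately show ?thesis by blast
qed

end
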